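(* The core-EP order is a pre-order but not a partial order. That is: for every $n\ge 1$ the relation $\overset{(\dag)}{\le}$ on $\mathbb{C}_{n,n}$ is reflexive and transitive, but it is not antisymmetric in general, i.e. there exist $n$ and $A,B\in\mathbb{C}_{n,n}$ with $A\overset{(\dag)}{\le}B$, $B\overset{(\dag)}{\le}A$ and $A\ne B$.
   Context: $\mathbb{C}_{n,n}$ is the set of $n\times n$ complex matrices, $A^\ast$ is the conjugate transpose, $\mathrm{rk}$ the rank, $\mathcal{R}(A)$ the column space. The index $\mathrm{Ind}(A)$ is $0$ if $A$ is non-singular, and otherwise is the smallest positive integer $k$ with $\mathrm{rk}(A^{k+1})=\mathrm{rk}(A^k)$. Core-EP inverse: for $A\in\mathbb{C}_{n,n}$ with $\mathrm{Ind}(A)=k$, $A^{(\dag)}$ is the unique $X\in\mathbb{C}_{n,n}$ satisfying $XA^{k+1}=A^k$, $XAX=X$, $(AX)^\ast=AX$ and $\mathcal{R}(X)\subseteq\mathcal{R}(A^k)$. Core-EP order: for $A,B\in\mathbb{C}_{n,n}$, $A\overset{(\dag)}{\le}B$ means $A^{(\dag)}A=A^{(\dag)}B$ and $AA^{(\dag)}=BA^{(\dag)}$. A pre-order is a reflexive and transitive relation; a partial order is an antisymmetric pre-order. *)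

theory Defs
  imports Complex_Main "Jordan_Normal_Form.DL_Rank" "Jordan_Normal_Form.Schur_Decomposition"
begin

text \<open>
  All definitions below are meant for square matrices \<open>A \<in> carrier_mat n n\<close>, for which
  \<open>dim_row A = n\<close>.
\<close>

definition mat_index :: "complex mat \<Rightarrow> nat" where
  "mat_index A =
     (if invertible_mat A then 0
      else (LEAST k. 0 < k \<and>
        vec_space.rank (dim_row A) (A ^\<^sub>m (k + 1)) = vec_space.rank (dim_row A) (A ^\<^sub>m k)))"

definition is_core_EP_inverse :: "complex mat \<Rightarrow> complex mat \<Rightarrow> bool" where
  "is_core_EP_inverse A X \<longleftrightarrow>
     X \<in> carrier_mat (dim_row A) (dim_row A) \<and>
     X * A ^\<^sub>m (mat_index A + 1) = A ^\<^sub>m mat_index A \<and>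
     X * A * X = X \<and>
     mat_adjoint (A * X) = A * X \<and>
     vec_space.col_space (dim_row A) X \<subseteq> vec_space.col_space (dim_row A) (A ^\<^sub>m mat_index A)"

definition core_EP_inverse :: "complex mat \<Rightarrow> complex mat" where
  "core_EP_inverse A = (THE X. is_core_EP_inverse A X)"

definition core_EP_le :: "complex mat \<Rightarrow> complex mat \<Rightarrow> bool" where
  "core_EP_le A B \<longleftrightarrow>
     core_EP_inverse A * A = core_EP_inverse A * B \<and>
     A * core_EP_inverse A = B * core_EP_inverse A"

end

theory Submission
  imports Defs
begin

text \<open>Let \<open>X\<close>, \<open>Y\<close> be the core-EP inverses of \<open>A\<close>, \<open>B\<close>, and let \<open>A\<close> be below \<open>B\<close>. Then \<open>A\<close> and
  \<open>B\<close> agree on the range of \<open>A\<^sup>k\<close>, on which \<open>A\<close> is bijective, so this range lies in the range of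
  every power of \<open>B\<close>. Hence \<open>X = Y * B * X\<close>, and, since \<open>A * X\<close> and \<open>B * Y\<close> are Hermitian, also
  \<open>X = X * B * Y\<close>; these two identities carry the defining equations of the order from the pair
  \<open>B\<close>, \<open>C\<close> over to \<open>A\<close>, \<open>C\<close>. Antisymmetry fails because the core-EP inverse ignores the
  nilpotent part.\<close>

section \<open>Conjugate transposes and generalized inverses\<close>

lemma mat_adjoint_eq:
  "mat_adjoint A = mat (dim_col A) (dim_row A) (\<lambda>(i, j). conjugate (A $$ (j, i)))"
  unfolding mat_adjoint_def by (rule eq_matI) (auto simp: mat_of_rows_index)

lemma mat_adjoint_carrier [simp]:
  "A \<in> carrier_mat nr nc \<Longrightarrow> mat_adjoint A \<in> carrier_mat nc nr"
  by (auto simp: mat_adjoint_eq)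

lemma mat_adjoint_adjoint [simp]: "mat_adjoint (mat_adjoint A) = A"
  by (rule eq_matI) (auto simp: mat_adjoint_eq)

lemma mat_adjoint_mult:
  fixes A :: "'a :: conjugatable_field mat"
  assumes "A \<in> carrier_mat nr n" "B \<in> carrier_mat n nc"
  shows "mat_adjoint (A * B) = mat_adjoint B * mat_adjoint A"
  using assms
  by (intro eq_matI)
    (auto simp: mat_adjoint_eq scalar_prod_def sum_conjugate conjugate_dist_mul mult.commute)

text \<open>The diagonal of \<open>mat_adjoint A * A\<close> holds the squared Euclidean norms of
  the columns of \<open>A\<close>.\<close>

lemma mat_adjoint_mult_self_eq_0:
  fixes A :: "complex mat"
  assumes A: "A \<in> carrier_mat nr nc" and zero: "mat_adjoint A * A = 0\<^sub>m nc nc"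
  shows "A = 0\<^sub>m nr nc"
proof (rule eq_matI)
  fix i j assume "i < dim_row (0\<^sub>m nr nc :: complex mat)" "j < dim_col (0\<^sub>m nr nc :: complex mat)"
  then have i: "i < nr" and j: "j < nc" by auto
  have "(mat_adjoint A * A) $$ (j, j) = (\<Sum>i<nr. cnj (A $$ (i, j)) * A $$ (i, j))"
    using A j by (auto simp: mat_adjoint_eq scalar_prod_def atLeast0LessThan)
  also have "\<dots> = (\<Sum>i<nr. of_real ((cmod (A $$ (i, j)))\<^sup>2))"
    by (intro sum.cong refl) (simp only: complex_norm_square mult.commute)
  finally have "complex_of_real (\<Sum>i<nr. (cmod (A $$ (i, j)))\<^sup>2) = 0"
    using zero j by simp
  then have "(\<Sum>i<nr. (cmod (A $$ (i, j)))\<^sup>2) = 0"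
    using of_real_eq_0_iff by blast
  then have "(cmod (A $$ (i, j)))\<^sup>2 = 0"
    using i by (subst (asm) sum_nonneg_eq_0_iff) auto
  then show "A $$ (i, j) = 0\<^sub>m nr nc $$ (i, j)" using i j by simp
qed (use A in auto)

text \<open>For \<open>D = M * (X - Y)\<close> the hypothesis becomes
  \<open>mat_adjoint M * D = 0\<close>, hence \<open>mat_adjoint D * D = 0\<close>.\<close>

lemma mat_adjoint_mult_cancel:
  fixes M :: "complex mat"
  assumes M: "M \<in> carrier_mat nr n" and X: "X \<in> carrier_mat n nc" and Y: "Y \<in> carrier_mat n nc"
    and eq: "mat_adjoint M * M * X = mat_adjoint M * M * Y"
  shows "M * X = M * Y"
proof -
  have M': "mat_adjoint M \<in> carrier_mat n nr" using M by simp
  then have MM: "mat_adjoint M * M \<in> carrier_mat n n" using M by (rule mult_carrier_mat)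
  define D where "D = M * X - M * Y"
  have D: "D \<in> carrier_mat nr nc" and D': "D = M * (X - Y)"
    using M X Y by (auto simp: D_def mult_minus_distrib_mat)
  have "mat_adjoint M * D = mat_adjoint M * M * X - mat_adjoint M * M * Y"
    using M M' X Y by (simp add: D_def mult_minus_distrib_mat[of _ n nr _ nc]
        assoc_mult_mat[of _ n nr _ n _ nc])
  also have "\<dots> = 0\<^sub>m n nc"
    unfolding eq by (rule minus_r_inv_mat[OF mult_carrier_mat[OF MM Y]])
  finally have "mat_adjoint (X - Y) * (mat_adjoint M * D) = 0\<^sub>m nc nc"
    using right_mult_zero_mat[OF mat_adjoint_carrier[OF minus_carrier_mat[OF Y]]] by simp
  moreover have "mat_adjoint D = mat_adjoint (X - Y) * mat_adjoint M"
    unfolding D' by (rule mat_adjoint_mult[OF M minus_carrier_mat[OF Y]])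
  ultimately have "mat_adjoint D * D = 0\<^sub>m nc nc"
    using assoc_mult_mat[OF mat_adjoint_carrier[OF minus_carrier_mat[OF Y]] M' D] by simp
  then have "D = 0\<^sub>m nr nc" using D by (rule mat_adjoint_mult_self_eq_0[rotated])
  show ?thesis
  proof (rule eq_matI)
    fix i j assume ij: "i < dim_row (M * Y)" "j < dim_col (M * Y)"
    then have "D $$ (i, j) = 0" using \<open>D = 0\<^sub>m nr nc\<close> M Y by simp
    then show "(M * X) $$ (i, j) = (M * Y) $$ (i, j)" using ij M X Y by (simp add: D_def)
  qed (use M X Y in auto)
qed

text \<open>Row reduction gives \<open>E = P * A\<close> with \<open>P\<close> invertible; an inner
  inverse \<open>K\<close> of the echelon form \<open>E\<close> yields the inner inverse
  \<open>K * P\<close> of \<open>A\<close>.\<close>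

lemma inner_inverse_exists:
  fixes A :: "'a :: field mat"
  assumes A: "A \<in> carrier_mat nr nc"
  obtains G where "G \<in> carrier_mat nc nr" "A * G * A = A"
proof -
  define E where "E = gauss_jordan_single A"
  note E = gauss_jordan_single[OF A E_def[symmetric]]
  obtain P Q where PQ: "E = P * A" "P \<in> carrier_mat nr nr" "Q \<in> carrier_mat nr nr"
    "Q * P = 1\<^sub>m nr" using E(4) by blast
  obtain f where f: "pivot_fun E f nc" using E(2,3) unfolding row_echelon_form_def by auto
  note piv = pivot_funD[OF carrier_matD(1)[OF E(2)] f]
  \<comment> \<open>Column \<open>i\<close> of \<open>K\<close> is the unit vector at the pivot of
    row \<open>i\<close>; it is zero if \<open>f i = nc\<close>, the value of \<open>f\<close> on
    zero rows.\<close>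
  define K where "K = mat nc nr (\<lambda>(j, i). if f i = j then 1 else (0 :: 'a))"
  have K: "K \<in> carrier_mat nc nr" by (simp add: K_def)
  \<comment> \<open>A pivot column of \<open>E\<close> is a unit vector, so \<open>E * K\<close> is the diagonal projection onto the
    pivot rows; the remaining rows of \<open>E\<close> vanish.\<close>
  have EK: "(E * K) $$ (a, i) = (if a = i \<and> f i < nc then 1 else 0)" if "a < nr" "i < nr" for a i
  proof -
    have "(E * K) $$ (a, i) = (\<Sum>j<nc. E $$ (a, j) * (if f i = j then 1 else 0))"
      using that E(2) K by (auto simp: scalar_prod_def K_def atLeast0LessThan intro!: sum.cong)
    also have "\<dots> = (if f i < nc then E $$ (a, f i) else 0)"
      by (simp add: sum.delta if_distrib[of "\<lambda>x. _ * x"] cong: if_cong)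
    finally show ?thesis using piv(4,5) that by auto
  qed
  have "E * K * E = E"
  proof (rule eq_matI)
    fix a c assume "a < dim_row E" "c < dim_col E"
    then have ac: "a < nr" "c < nc" using E(2) by auto
    define T where "T = E * K"
    have "(T * E) $$ (a, c) = (\<Sum>i<nr. T $$ (a, i) * E $$ (i, c))"
      using ac E(2) K mult_carrier_mat[OF E(2) K]
      by (auto simp: T_def[symmetric] scalar_prod_def atLeast0LessThan)
    then have "(E * K * E) $$ (a, c) = (\<Sum>i<nr. (E * K) $$ (a, i) * E $$ (i, c))"
      unfolding T_def .
    also have "\<dots> = (\<Sum>i<nr. if i = a then (if f a < nc then E $$ (a, c) else 0) else 0)"
      using ac by (intro sum.cong refl) (auto simp: EK)
    also have "\<dots> = E $$ (a, c)"
      using ac piv(1)[of a] piv(2)[of a c] by (auto simp: sum.delta)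
    finally show "(E * K * E) $$ (a, c) = E $$ (a, c)" .
  qed (use E(2) K in auto)
  have "Q * E = Q * P * A" using PQ(1-3) A by (simp add: assoc_mult_mat[of _ nr nr _ nr _ nc])
  then have AQ: "A = Q * E" using PQ(4) A by simp
  have "A * (K * P) * A = Q * E * (K * P) * A" by (simp only: AQ[symmetric])
  also have "\<dots> = Q * (E * K * (P * A))"
    using PQ(2,3) A E(2) K
    by (simp add: assoc_mult_mat[of _ nr nr _ nc _ nr] assoc_mult_mat[of _ nr nr _ nc _ nc]
        assoc_mult_mat[of _ nr nr _ nr _ nc] assoc_mult_mat[of _ nr nc _ nr _ nr]
        assoc_mult_mat[of _ nc nr _ nr _ nc] assoc_mult_mat[of _ nr nc _ nr _ nc])
  also have "\<dots> = A" by (simp only: PQ(1)[symmetric] \<open>E * K * E = E\<close> AQ[symmetric])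
  finally show ?thesis by (rule that[OF mult_carrier_mat[OF K PQ(2)]])
qed

text \<open>A least-squares inverse: for an inner inverse \<open>G\<close> of
  \<open>H = mat_adjoint M * M\<close>, the adjoint of \<open>V = M * G\<close> works, since
  \<open>V * H = M\<close> gives \<open>V * mat_adjoint M = M * mat_adjoint V\<close>.\<close>

lemma hermitian_inner_inverse_exists:
  fixes M :: "complex mat"
  assumes M: "M \<in> carrier_mat n n"
  obtains G where "G \<in> carrier_mat n n" "M * G * M = M" "mat_adjoint (M * G) = M * G"
proof -
  define H where "H = mat_adjoint M * M"
  have M': "mat_adjoint M \<in> carrier_mat n n" using M by simp
  then have H: "H \<in> carrier_mat n n" using M unfolding H_def by (rule mult_carrier_mat)
  obtain G where G: "G \<in> carrier_mat n n" "H * G * H = H" using inner_inverse_exists[OF H] .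
  have "M * (G * H) = M * 1\<^sub>m n"
    using M H G by (intro mat_adjoint_mult_cancel[of M n n _ n])
      (auto simp: H_def[symmetric] assoc_mult_mat[of _ n n _ n _ n])
  define V where "V = M * G"
  have V: "V \<in> carrier_mat n n" using M G by (simp add: V_def)
  note assoc = assoc_mult_mat[of _ n n _ n _ n]
  have VM: "V * (mat_adjoint M * M) = M"
    using \<open>M * (G * H) = M * 1\<^sub>m n\<close> M G(1) H by (simp add: V_def assoc H_def[symmetric])
  have V': "mat_adjoint V \<in> carrier_mat n n" using V by simp
  have H_adj: "mat_adjoint H = H" using M M' by (simp add: H_def mat_adjoint_mult[of _ n n _ n])
  have "mat_adjoint M = mat_adjoint (V * H)" using VM by (simp add: H_def)
  also have "\<dots> = H * mat_adjoint V"
    using H V by (simp add: mat_adjoint_mult[of _ n n _ n] H_adj)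
  finally have "V * mat_adjoint M = V * (H * mat_adjoint V)" by simp
  then have "V * mat_adjoint M = V * (mat_adjoint M * M) * mat_adjoint V"
    using V V' H by (simp add: H_def[symmetric] assoc)
  then have MV: "V * mat_adjoint M = M * mat_adjoint V" using VM by simp
  have "M * mat_adjoint V * M = M" using M M' V VM by (simp add: MV[symmetric] assoc)
  moreover have "mat_adjoint (M * mat_adjoint V) = M * mat_adjoint V"
    using M V V' by (simp add: mat_adjoint_mult[of _ n n _ n] MV)
  ultimately show ?thesis using that[OF V'] by simp
qed

text \<open>If \<open>A\<close> maps the range of \<open>M\<close> onto a superset of it, then it is injective there. With
  \<open>e = M * G\<close> a projection onto that range, the hypothesis makes \<open>A * e + (1 - e)\<close> right
  invertible, hence invertible.\<close>

lemma left_factor_of_right_factor: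
  fixes A :: "'a :: field mat"
  assumes A: "A \<in> carrier_mat n n" and M: "M \<in> carrier_mat n n" and W: "W \<in> carrier_mat n n"
    and eq: "M = A * M * W"
  obtains V where "V \<in> carrier_mat n n" "M = V * (A * M)"
proof -
  note assoc = assoc_mult_mat[of _ n n _ n _ n]
  obtain G where G: "G \<in> carrier_mat n n" "M * G * M = M" using inner_inverse_exists[OF M] .
  define e where "e = M * G"
  define f where "f = 1\<^sub>m n - e"
  \<comment> \<open>\<open>b\<close> inverts \<open>A\<close> on the range of \<open>M\<close>:
    \<open>A * b = e\<close>, \<open>e * b = b\<close> and \<open>f * b = 0\<close>. So
    \<open>b + f\<close> is a right inverse of \<open>A * e + f\<close>.\<close>
  define b where "b = M * W * G"
  have c: "e \<in> carrier_mat n n" "f \<in> carrier_mat n n" "b \<in> carrier_mat n n"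
    using M G W by (auto simp: e_def f_def b_def)
  have eM: "e * M = M" using G by (simp add: e_def)
  have ee: "e * e = e"
  proof -
    have "e * e = e * M * G" using M G(1) c(1) by (simp add: e_def assoc)
    then show ?thesis by (simp only: eM) (simp only: e_def)
  qed
  have fM: "f * M = 0\<^sub>m n n"
    using M c eM by (simp add: f_def minus_mult_distrib_mat[of _ n n _ _ n])
  have fb: "f * b = 0\<^sub>m n n"
  proof -
    have "f * b = f * M * W * G" using M W G c by (simp add: b_def assoc)
    then show ?thesis using fM W G by simp
  qed
  have eb: "e * b = b"
  proof -
    have "e * b = e * M * W * G" using M W G c by (simp add: b_def assoc)
    then show ?thesis by (simp add: eM b_def)
  qed
  have ef: "e * f = 0\<^sub>m n n"
    using c ee by (simp add: f_def mult_minus_distrib_mat[of _ n n _ n])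
  have fe: "f * e = 0\<^sub>m n n"
    using c ee by (simp add: f_def minus_mult_distrib_mat[of _ n n _ _ n])
  have ff: "f * f = f"
  proof -
    have "f * f = f * 1\<^sub>m n - f * e"
      using c by (subst (2) f_def) (simp add: mult_minus_distrib_mat[of _ n n _ n])
    then show ?thesis using c fe by auto
  qed
  have "A * b = A * M * W * G" using A M W G by (simp add: b_def assoc)
  then have Ab: "A * b = e" using eq by (simp add: e_def)
  have "(A * e + f) * (b + f) = A * (e * b) + f * b + (A * (e * f) + f * f)"
    using A c by (simp add: add_mult_distrib_mat[of _ n n _ _ n] mult_add_distrib_mat[of _ n n _ n]
        assoc)
  also have "\<dots> = e + f" using A c by (simp add: eb ef fb ff Ab)
  also have "\<dots> = 1\<^sub>m n" using c by (auto simp: f_def)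
  finally have "(b + f) * (A * e + f) = 1\<^sub>m n"
    using A c by (intro mat_mult_left_right_inverse[of "A * e + f" n "b + f"]) auto
  then have "M = (b + f) * (A * e + f) * M" using M by simp
  also have "\<dots> = (b + f) * (A * (e * M) + f * M)"
    using A M c by (simp add: add_mult_distrib_mat[of "A * e" n n _ _ n] assoc)
  also have "\<dots> = (b + f) * (A * M)" using A M by (simp add: eM fM)
  finally show ?thesis using that[of "b + f"] c by simp
qed

section \<open>Column spaces, ranks and the index\<close>

lemma col_space_mult_subset:
  fixes A :: "'a :: field mat"
  assumes A: "A \<in> carrier_mat n m" and B: "B \<in> carrier_mat m nc"
  shows "vec_space.col_space n (A * B) \<subseteq> vec_space.col_space n A"
proof -
  interpret vec_space "TYPE('a)" n .
  have AB: "A * B \<in> carrier_mat n nc" using A B by simp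
  show ?thesis
  proof
    fix y assume "y \<in> col_space (A * B)"
    then obtain x where x: "x \<in> carrier_vec nc" "y = A * B *\<^sub>v x"
      using B unfolding col_space_eq[OF AB] by auto
    then have "y = A *\<^sub>v (B *\<^sub>v x)" using A B by (simp add: assoc_mult_mat_vec)
    then show "y \<in> col_space A"
      using A B x by (auto simp: col_space_eq[OF A] intro!: bexI[of _ "B *\<^sub>v x"])
  qed
qed

text \<open>Preimages under \<open>A\<close> of the columns of \<open>X\<close> form the columns of
  \<open>Z\<close>. This turns range inclusions into matrix equations.\<close>

lemma factor_of_col_space_subset:
  fixes A :: "'a :: field mat"
  assumes A: "A \<in> carrier_mat n m" and X: "X \<in> carrier_mat n nc"
    and sub: "vec_space.col_space n X \<subseteq> vec_space.col_space n A"
  obtains Z where "Z \<in> carrier_mat m nc" "X = A * Z"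
proof -
  interpret vec_space "TYPE('a)" n .
  have "\<exists>z\<in>carrier_vec m. A *\<^sub>v z = col X j" if "j < nc" for j
  proof -
    have "col X j \<in> set (cols X)" using X that by (auto simp: cols_def)
    then have "col X j \<in> col_space X"
      unfolding col_space_def using X cols_dim[of X] by (intro span_mem) auto
    then show ?thesis using sub A by (auto simp: col_space_eq[OF A])
  qed
  then obtain z where z: "\<And>j. j < nc \<Longrightarrow> z j \<in> carrier_vec m \<and> A *\<^sub>v z j = col X j" by metis
  define Z where "Z = mat_of_cols m (map z [0..<nc])"
  have Z: "Z \<in> carrier_mat m nc" by (simp add: Z_def mat_of_cols_def)
  have colZ: "col Z j = z j" if "j < nc" for j
    using that z by (simp add: Z_def)
  have "X = A * Z"
  proof (rule mat_col_eqI)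
    fix j assume "j < dim_col (A * Z)"
    then have j: "j < nc" using Z by simp
    show "col X j = col (A * Z) j"
      using z[OF j] colZ[OF j] col_mult2[OF A Z j] by simp
  qed (use A X Z in auto)
  then show ?thesis using that Z by blast
qed

text \<open>A maximal independent set of columns of \<open>X\<close> stays independent in the column
  space of \<open>A\<close>; at equal rank it is a basis of that space.\<close>

lemma rank_mono:
  fixes A :: "'a :: field mat"
  assumes A: "A \<in> carrier_mat n m" and X: "X \<in> carrier_mat n nc"
    and sub: "vec_space.col_space n X \<subseteq> vec_space.col_space n A"
  shows "vec_space.rank n X \<le> vec_space.rank n A"
    and "vec_space.rank n X = vec_space.rank n A \<Longrightarrow>
      vec_space.col_space n X = vec_space.col_space n A"
proof -
  interpret vec_space "TYPE('a)" n .
  let ?A = "span_vs (set (cols A))" and ?X = "set (cols X)"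
  have cA: "set (cols A) \<subseteq> carrier_vec n" and cX: "?X \<subseteq> carrier_vec n"
    using A X cols_dim by blast+
  interpret A: vectorspace class_ring ?A
    using span_is_subspace[THEN subspace_is_vs, of "set (cols A)"] cA by auto
  have sm: "submodule class_ring (span (set (cols A))) V" using cA by (simp add: span_is_submodule)
  have fd: "A.fin_dim" using fin_dim_span_cols[OF A] .
  obtain S where S: "finite S" "maximal S (\<lambda>T. T \<subseteq> ?X \<and> lin_indpt T)"
    using maximal_exists_superset[of ?X "\<lambda>T. T \<subseteq> ?X \<and> lin_indpt T" "{}"]
    by (auto simp: lin_dep_def)
  have rX: "rank X = card S" by (rule rank_card_indpt[OF X S(2)])
  have SX: "S \<subseteq> ?X" "lin_indpt S" using S(2) by (auto simp: maximal_def)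
  have "?X \<subseteq> span ?X" using cX by (rule in_own_span)
  then have SA: "S \<subseteq> span (set (cols A))" using SX sub by (auto simp: col_space_def)
  have liA: "A.lin_indpt S" using span_li_not_depend(2)[OF SA sm] SX by simp
  have "card S \<le> rank A"
    unfolding rank_def using A.li_le_dim(2)[OF fd _ liA] SA by simp
  then show "rank X \<le> rank A" by (simp add: rX)
  assume "rank X = rank A"
  then have "rank A = card S" by (simp add: rX)
  then have "A.dim \<le> card S" by (simp add: rank_def)
  then have "A.basis S" using A.dim_li_is_basis[OF fd S(1) _ liA] SA by simp
  then have "A.span S = span (set (cols A))" by (simp add: A.basis_def)
  then have "span (set (cols A)) = span S" using span_li_not_depend(1)[OF SA sm] by simp
  also have "\<dots> \<subseteq> span ?X" using SX(1) by (rule span_is_monotone)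
  finally show "col_space X = col_space A" using sub by (auto simp: col_space_def)
qed

lemma pow_mat_Suc_left:
  fixes A :: "'a :: semiring_1 mat"
  assumes "A \<in> carrier_mat n n"
  shows "A ^\<^sub>m Suc k = A * A ^\<^sub>m k"
proof (induction k)
  case (Suc k)
  have "A ^\<^sub>m Suc (Suc k) = A * A ^\<^sub>m k * A" using Suc by simp
  also have "\<dots> = A * (A ^\<^sub>m k * A)"
    using assms by (intro assoc_mult_mat[of _ n n _ n _ n]) auto
  finally show ?case by simp
qed (use assms in simp)

text \<open>The equation is substituted into itself \<open>j\<close> times, so the range of
  \<open>M\<close> lies in that of every power of \<open>B\<close>.\<close>

lemma right_factor_pow:
  fixes B :: "'a :: semiring_1 mat"
  assumes B: "B \<in> carrier_mat n n" and M: "M \<in> carrier_mat n n" and W: "W \<in> carrier_mat n n"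
    and eq: "M = B * M * W"
  obtains Z where "Z \<in> carrier_mat n n" "M = B ^\<^sub>m j * M * Z"
proof -
  have "\<exists>Z\<in>carrier_mat n n. M = B ^\<^sub>m j * M * Z"
  proof (induction j)
    case 0
    then show ?case using B M by (auto intro!: bexI[of _ "1\<^sub>m n"])
  next
    case (Suc j)
    then obtain Z where Z: "Z \<in> carrier_mat n n" "M = B ^\<^sub>m j * M * Z" by blast
    have "M = B ^\<^sub>m j * (B * M * W) * Z" unfolding eq[symmetric] by (rule Z(2))
    also have "\<dots> = B ^\<^sub>m Suc j * M * (W * Z)"
      using B M W Z(1) by (simp add: assoc_mult_mat[of _ n n _ n _ n])
    finally have "M = B ^\<^sub>m Suc j * M * (W * Z)" .
    then show ?case using W Z(1) by (intro bexI[of _ "W * Z"]) auto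
  qed
  then show ?thesis using that by blast
qed

text \<open>Ensures that the \<open>LEAST\<close> in \<open>mat_index\<close> is attained: otherwise
  the ranks of the powers would decrease strictly forever.\<close>

lemma rank_pow_stabilizes:
  fixes A :: "'a :: field mat"
  assumes A: "A \<in> carrier_mat n n"
  shows "\<exists>k>0. vec_space.rank n (A ^\<^sub>m (k + 1)) = vec_space.rank n (A ^\<^sub>m k)"
proof (rule ccontr)
  assume neg: "\<not> ?thesis"
  let ?r = "\<lambda>k. vec_space.rank n (A ^\<^sub>m k)"
  have "?r (Suc k) \<le> ?r k" for k
    using A col_space_mult_subset[of "A ^\<^sub>m k" n n A n]
    by (intro rank_mono(1)[of _ n n _ n]) auto
  then have "?r (Suc (Suc k)) < ?r (Suc k)" for k
    using neg by (metis Suc_eq_plus1 le_neq_implies_less zero_less_Suc)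
  then have "?r (Suc k) + k \<le> ?r (Suc 0)" for k
  proof (induction k)
    case (Suc k)
    then show ?case by (metis add_Suc_right add_Suc Suc_leI add_le_mono1 le_trans)
  qed simp
  from this[of "Suc (?r (Suc 0))"] show False by simp
qed

text \<open>The form in which the index is used: \<open>A\<close> maps the range of its power onto
  that range. For invertible \<open>A\<close> the power is the identity and \<open>W\<close> the
  inverse; otherwise equal ranks make the nested column spaces equal.\<close>

lemma pow_mat_index_right_factor:
  assumes A: "A \<in> carrier_mat n n"
  obtains W where "W \<in> carrier_mat n n" "A ^\<^sub>m mat_index A = A * A ^\<^sub>m mat_index A * W"
proof (cases "invertible_mat A")
  case True
  then obtain B where B: "A * B = 1\<^sub>m n" "B * A = 1\<^sub>m (dim_row B)"
    using A unfolding invertible_mat_def inverts_mat_def by auto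
  then have "B \<in> carrier_mat n n"
    using A by (metis carrier_matD(2) carrier_matI index_mult_mat(3) index_one_mat(3))
  then show ?thesis using that[of B] True A B by (simp add: mat_index_def)
next
  case False
  let ?P = "\<lambda>k. 0 < k \<and> vec_space.rank n (A ^\<^sub>m (k + 1)) = vec_space.rank n (A ^\<^sub>m k)"
  have "mat_index A = (LEAST k. ?P k)" using A False by (simp add: mat_index_def)
  moreover have "?P (LEAST k. ?P k)"
    by (rule LeastI_ex[OF rank_pow_stabilizes[OF A]])
  ultimately have eq: "vec_space.rank n (A ^\<^sub>m Suc (mat_index A)) =
      vec_space.rank n (A ^\<^sub>m mat_index A)" by simp
  let ?M = "A ^\<^sub>m mat_index A"
  have M: "?M \<in> carrier_mat n n" and AM: "A ^\<^sub>m Suc (mat_index A) \<in> carrier_mat n n"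
    using A by (auto intro!: pow_carrier_mat simp del: pow_mat.simps)
  have "vec_space.col_space n (A ^\<^sub>m Suc (mat_index A)) = vec_space.col_space n ?M"
    by (rule rank_mono(2)[OF M AM _ eq]) (use col_space_mult_subset[OF M A] in simp)
  then obtain W where "W \<in> carrier_mat n n" "?M = A ^\<^sub>m Suc (mat_index A) * W"
    using factor_of_col_space_subset[OF AM M] by auto
  then show ?thesis using that[of W] pow_mat_Suc_left[OF A] by simp
qed

section \<open>The core-EP inverse\<close>

lemma is_core_EP_inverse_iff:
  assumes A: "A \<in> carrier_mat n n" and M: "M = A ^\<^sub>m mat_index A"
  shows "is_core_EP_inverse A X \<longleftrightarrow>
    X \<in> carrier_mat n n \<and> X * (A * M) = M \<and> X * A * X = X \<and> mat_adjoint (A * X) = A * X \<and>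
    (\<exists>Z\<in>carrier_mat n n. X = M * Z)"
proof -
  have Mc: "M \<in> carrier_mat n n" using A M by simp
  have AM: "A ^\<^sub>m (mat_index A + 1) = A * M"
    using pow_mat_Suc_left[OF A, of "mat_index A"] M by simp
  have range: "vec_space.col_space n X \<subseteq> vec_space.col_space n M \<longleftrightarrow> (\<exists>Z\<in>carrier_mat n n. X = M * Z)"
    if "X \<in> carrier_mat n n"
    using factor_of_col_space_subset[OF Mc that] col_space_mult_subset[OF Mc] by blast
  then show ?thesis
    unfolding is_core_EP_inverse_def carrier_matD(1)[OF A] AM M[symmetric]
    using range by blast
qed

text \<open>With \<open>k\<close> the index of \<open>A\<close>, the witness is \<open>A\<^sup>k * G\<close> for an inner inverse \<open>G\<close> of
  \<open>A\<^sup>k\<^sup>+\<^sup>1\<close> that makes \<open>A\<^sup>k\<^sup>+\<^sup>1 * G\<close> Hermitian.\<close>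

lemma core_EP_inverse_exists:
  assumes A: "A \<in> carrier_mat n n"
  shows "\<exists>X. is_core_EP_inverse A X"
proof -
  note assoc = assoc_mult_mat[of _ n n _ n _ n]
  define M where "M = A ^\<^sub>m mat_index A"
  have M: "M \<in> carrier_mat n n" using A by (simp add: M_def)
  obtain W where "W \<in> carrier_mat n n" "M = A * M * W"
    using pow_mat_index_right_factor[OF A] unfolding M_def .
  then obtain V where V: "V \<in> carrier_mat n n" "M = V * (A * M)"
    using left_factor_of_right_factor[OF A M] by blast
  define N where "N = A * M"
  have N: "N \<in> carrier_mat n n" using A M by (simp add: N_def)
  obtain G where G: "G \<in> carrier_mat n n" "N * G * N = N" "mat_adjoint (N * G) = N * G"
    using hermitian_inner_inverse_exists[OF N] .
  define X where "X = M * G"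
  have X: "X \<in> carrier_mat n n" using M G(1) by (simp add: X_def)
  have NGN: "N * (G * N) = N" using assoc[OF N G(1) N] G(2) by simp
  \<comment> \<open>A trailing factor \<open>Y\<close> lets the identity rewrite inside
    right-associated products. Below, \<open>M = V * N\<close> passes it from \<open>N\<close> to
    \<open>M\<close>.\<close>
  have NGNY: "N * (G * (N * Y)) = N * Y" if "Y \<in> carrier_mat n n" for Y
    using arg_cong[OF NGN, of "\<lambda>T. T * Y"] N G(1) that by (simp add: assoc)
  have MGNY: "M * (G * (N * Y)) = M * Y" if "Y \<in> carrier_mat n n" for Y
  proof -
    have "M * (G * (N * Y)) = V * (N * (G * (N * Y)))"
      using V(1) N G(1) A M that by (subst V(2)) (simp add: N_def assoc)
    also have "\<dots> = V * N * Y" using V(1) N that by (simp add: NGNY assoc)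
    finally show ?thesis by (simp only: N_def V(2)[symmetric])
  qed
  have AX: "A * X = N * G" using A M G(1) by (simp add: X_def N_def assoc)
  have "X * N = M"
    using MGNY[of "1\<^sub>m n"] M G(1) N by (simp add: X_def assoc)
  moreover have "X * A * X = X"
  proof -
    have "X * A * X = X * (A * X)" using X A by (simp add: assoc)
    also have "\<dots> = M * G * (N * G)" by (simp only: AX) (simp only: X_def)
    also have "\<dots> = M * G" using MGNY[OF G(1)] M G(1) N by (simp add: assoc)
    finally show ?thesis by (simp add: X_def)
  qed
  moreover have "mat_adjoint (A * X) = A * X" using G by (simp add: AX)
  moreover have "\<exists>Z\<in>carrier_mat n n. X = M * Z" using X_def G(1) by blast
  ultimately show ?thesis
    using X is_core_EP_inverse_iff[OF A M_def] by (auto simp: N_def)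
qed

lemma core_EP_inverse_unique:
  assumes A: "A \<in> carrier_mat n n" and "is_core_EP_inverse A X" and "is_core_EP_inverse A Y"
  shows "X = Y"
proof -
  note assoc = assoc_mult_mat[of _ n n _ n _ n]
  define M where "M = A ^\<^sub>m mat_index A"
  have M: "M \<in> carrier_mat n n" using A by (simp add: M_def)
  obtain W where W: "W \<in> carrier_mat n n" "M = A * M * W"
    using pow_mat_index_right_factor[OF A] unfolding M_def .
  have comm: "A * M = M * A" using pow_mat_Suc_left[OF A, of "mat_index A"] by (simp add: M_def)
  \<comment> \<open>Both \<open>A * X\<close> and \<open>A * Y\<close> are orthogonal projections onto the range of \<open>M\<close>.\<close>
  have proj: "A * X * (A * Y) = A * Y"
    if X: "X \<in> carrier_mat n n" "X * (A * M) = M"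
      and Y: "Z \<in> carrier_mat n n" "Y = M * Z" for X Y Z
  proof -
    have "A * X * M = A * (X * (A * M)) * W"
      using A M W(1) X(1) by (subst W(2)) (simp add: assoc)
    then have AXM: "A * X * M = M" by (simp only: X(2) W(2)[symmetric])
    have "A * Y = A * M * Z" using A M Y(1) by (simp add: Y(2) assoc)
    then have AY: "A * Y = M * (A * Z)" unfolding comm using A M Y(1) by (simp add: assoc)
    then have "A * X * (A * Y) = A * X * M * (A * Z)" using A M X(1) Y(1) by (simp add: assoc)
    then show ?thesis by (simp only: AXM AY)
  qed
  from assms obtain Z Z' where
    X: "X \<in> carrier_mat n n" "X * (A * M) = M" "X * A * X = X" "mat_adjoint (A * X) = A * X"
      "Z \<in> carrier_mat n n" "X = M * Z" and
    Y: "Y \<in> carrier_mat n n" "Y * (A * M) = M" "Y * A * Y = Y" "mat_adjoint (A * Y) = A * Y"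
      "Z' \<in> carrier_mat n n" "Y = M * Z'"
    unfolding is_core_EP_inverse_iff[OF A M_def] by blast
  \<comment> \<open>Hermitian projections with the same range coincide: taking adjoints swaps the
    factors of their product.\<close>
  have "A * X = mat_adjoint (A * Y * (A * X))" using proj[OF Y(1,2) X(5,6)] X(4) by simp
  also have "\<dots> = mat_adjoint (A * X) * mat_adjoint (A * Y)"
    using A X(1) Y(1) by (simp add: mat_adjoint_mult[of _ n n _ n])
  also have "\<dots> = A * Y" using proj[OF X(1,2) Y(5,6)] X(4) Y(4) by simp
  finally have eq: "A * X = A * Y" .
  \<comment> \<open>\<open>X * A\<close> fixes the range of \<open>M\<close>, which contains that of
    \<open>Y\<close>; so \<open>X = X * (A * Y) = Y\<close>.\<close>
  have "X = X * (A * X)" using assoc[OF X(1) A X(1)] X(3) by simp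
  also have "\<dots> = X * (A * M) * Z'" using A M X(1) Y(5) unfolding eq by (subst Y(6)) (simp add: assoc)
  also have "\<dots> = Y" using X(2) Y(6) by simp
  finally show ?thesis .
qed

lemma is_core_EP_inverse_core_EP_inverse:
  assumes "A \<in> carrier_mat n n"
  shows "is_core_EP_inverse A (core_EP_inverse A)"
  unfolding core_EP_inverse_def
  using core_EP_inverse_exists[OF assms] core_EP_inverse_unique[OF assms] by (blast intro: theI)

text \<open>The range of \<open>M\<close> lies in that of the \<open>j\<close>-th power, so
  \<open>M = 0\<close>, and the core-EP inverse has \<open>M\<close> as a left factor.\<close>

lemma core_EP_inverse_nilpotent:
  assumes A: "A \<in> carrier_mat n n" and nil: "A ^\<^sub>m j = 0\<^sub>m n n"
  shows "core_EP_inverse A = 0\<^sub>m n n"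
proof -
  define M where "M = A ^\<^sub>m mat_index A"
  have M: "M \<in> carrier_mat n n" using A by (simp add: M_def)
  obtain W where W: "W \<in> carrier_mat n n" "M = A * M * W"
    using pow_mat_index_right_factor[OF A] unfolding M_def .
  obtain Z where "Z \<in> carrier_mat n n" "M = A ^\<^sub>m j * M * Z"
    using right_factor_pow[OF A M W] .
  then have "M = 0\<^sub>m n n" using nil M by simp
  then show ?thesis
    using is_core_EP_inverse_core_EP_inverse[OF A] unfolding is_core_EP_inverse_iff[OF A M_def]
    by auto
qed

section \<open>The core-EP order\<close>

text \<open>Since \<open>j\<close> is arbitrary, it can be taken as the index of \<open>B\<close>,
  whatever the index of \<open>A\<close>.\<close>

lemma core_EP_le_range:
  assumes A: "A \<in> carrier_mat n n" and B: "B \<in> carrier_mat n n" and le: "core_EP_le A B"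
  obtains Z where "Z \<in> carrier_mat n n" "core_EP_inverse A = B ^\<^sub>m j * Z"
proof -
  note assoc = assoc_mult_mat[of _ n n _ n _ n]
  define M where "M = A ^\<^sub>m mat_index A"
  define X where "X = core_EP_inverse A"
  have M: "M \<in> carrier_mat n n" using A by (simp add: M_def)
  obtain W where W: "W \<in> carrier_mat n n" "M = A * M * W"
    using pow_mat_index_right_factor[OF A] unfolding M_def .
  obtain Y where X: "X \<in> carrier_mat n n" "X * (A * M) = M" "Y \<in> carrier_mat n n" "X = M * Y"
    using is_core_EP_inverse_core_EP_inverse[OF A]
    unfolding is_core_EP_inverse_iff[OF A M_def] X_def by blast
  \<comment> \<open>The factor \<open>A * M\<close> trades \<open>X\<close> for \<open>M\<close>,
    because \<open>X * (A * M) = M\<close>.\<close>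
  have "A * X * (A * M) = B * X * (A * M)" using le by (simp add: core_EP_le_def X_def)
  then have "A * (X * (A * M)) = B * (X * (A * M))" using A B M X(1) by (simp add: assoc)
  then have "A * M = B * M" by (simp only: X(2))
  then have MB: "M = B * M * W" using W(2) by simp
  obtain Z where Z: "Z \<in> carrier_mat n n" "M = B ^\<^sub>m j * M * Z"
    using right_factor_pow[OF B M W(1) MB] .
  have "X = B ^\<^sub>m j * M * Z * Y" by (simp only: Z(2)[symmetric] X(4))
  also have "\<dots> = B ^\<^sub>m j * (M * Z * Y)" using B M Z(1) X(3) by (simp add: assoc)
  finally have "X = B ^\<^sub>m j * (M * Z * Y)" .
  then show ?thesis using that[of "M * Z * Y"] M Z(1) X(3) by (simp add: X_def)
qed

lemma core_EP_le_trans: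
  assumes A: "A \<in> carrier_mat n n" and B: "B \<in> carrier_mat n n" and C: "C \<in> carrier_mat n n"
    and AB: "core_EP_le A B" and BC: "core_EP_le B C"
  shows "core_EP_le A C"
proof -
  note assoc = assoc_mult_mat[of _ n n _ n _ n]
  define X where "X = core_EP_inverse A"
  define Y where "Y = core_EP_inverse B"
  define M where "M = B ^\<^sub>m mat_index B"
  have M: "M \<in> carrier_mat n n" using B by (simp add: M_def)
  have X: "X \<in> carrier_mat n n" "X * A * X = X" "mat_adjoint (A * X) = A * X"
    using is_core_EP_inverse_core_EP_inverse[OF A]
    unfolding is_core_EP_inverse_iff[OF A refl] X_def by auto
  have Y: "Y \<in> carrier_mat n n" "Y * (B * M) = M" "mat_adjoint (B * Y) = B * Y"
    using is_core_EP_inverse_core_EP_inverse[OF B]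
    unfolding is_core_EP_inverse_iff[OF B M_def] Y_def by auto
  have XA: "X * A = X * B" and AX: "A * X = B * X" and YB: "Y * B = Y * C" and BY: "B * Y = C * Y"
    using AB BC by (auto simp: core_EP_le_def X_def Y_def)
  \<comment> \<open>Here \<open>j\<close> is the index of \<open>B\<close>, so that
    \<open>Y * B\<close> fixes the range of \<open>X\<close>.\<close>
  obtain Z where Z: "Z \<in> carrier_mat n n" "X = M * Z"
    using core_EP_le_range[OF A B AB] unfolding X_def M_def .
  have "Y * (B * (M * Z)) = Y * (B * M) * Z" using Y(1) B M Z(1) by (simp add: assoc)
  then have X_eq: "X = Y * (B * X)" by (simp only: Y(2) Z(2))
  have "C * X = C * Y * (B * X)"
    using C Y(1) B X(1) by (subst X_eq) (simp add: assoc)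
  also have "\<dots> = B * (Y * (B * X))" unfolding BY[symmetric] using Y(1) B X(1) by (simp add: assoc)
  also have "\<dots> = A * X" by (simp only: X_eq[symmetric] AX)
  finally have 1: "A * X = C * X" by simp
  \<comment> \<open>\<open>B * Y\<close> fixes the range of \<open>A * X\<close>; both being Hermitian, so does it from the right.\<close>
  have "B * Y * (A * X) = A * X"
  proof -
    have "B * Y * (B * X) = B * (Y * (B * X))" using B Y(1) X(1) by (simp add: assoc)
    then show ?thesis by (simp only: X_eq[symmetric] AX)
  qed
  then have "mat_adjoint (B * Y * (A * X)) = A * X" using X(3) by simp
  then have "A * X * (B * Y) = A * X"
    by (simp only: X(3) Y(3)
        mat_adjoint_mult[OF mult_carrier_mat[OF B Y(1)] mult_carrier_mat[OF A X(1)]])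
  \<comment> \<open>Multiplying by \<open>X\<close> on the left removes \<open>A * X\<close>, as
    \<open>X * A * X = X\<close>.\<close>
  then have "X * (A * X * (B * Y)) = X * (A * X)" by simp
  then have "X * A * X * (B * Y) = X * A * X" using A B X(1) Y(1) by (simp add: assoc)
  then have XBY: "X * (B * Y) = X" by (simp only: X(2))
  \<comment> \<open>Inserting \<open>B * Y\<close> after \<open>X\<close> makes
    \<open>Y * C = Y * B\<close> applicable; removing it again leaves \<open>X * B\<close>.\<close>
  have "X * C = X * (B * Y) * C" by (simp add: XBY)
  also have "\<dots> = X * B * (Y * C)" using X(1) B Y(1) C by (simp add: assoc)
  also have "\<dots> = X * (B * Y) * B"
    unfolding YB[symmetric] using X(1) B Y(1) by (simp add: assoc)
  also have "\<dots> = X * A" by (simp add: XBY XA)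
  finally show ?thesis using 1 by (simp add: core_EP_le_def X_def)
qed

theorem theorem4p3:
  shows "(\<forall>n\<ge>1. reflp_on (carrier_mat n n) core_EP_le \<and> transp_on (carrier_mat n n) core_EP_le) \<and>
    (\<exists>n\<ge>1. \<exists>A\<in>carrier_mat n n. \<exists>B\<in>carrier_mat n n.
       core_EP_le A B \<and> core_EP_le B A \<and> A \<noteq> B)"
proof (intro conjI allI impI)
  fix n :: nat
  show "reflp_on (carrier_mat n n) core_EP_le"
    by (auto intro: reflp_onI simp: core_EP_le_def)
  show "transp_on (carrier_mat n n) core_EP_le"
    by (rule transp_onI) (rule core_EP_le_trans)
next
  \<comment> \<open>Nilpotent matrices all have core-EP inverse 0, so they are mutually comparable.\<close>
  define A :: "complex mat" where "A = mat 2 2 (\<lambda>(i, j). if i = 0 \<and> j = 1 then 1 else 0)"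
  have A: "A \<in> carrier_mat 2 2" by (simp add: A_def)
  have "A ^\<^sub>m 2 = 0\<^sub>m 2 2"
    by (rule eq_matI) (auto simp: A_def numeral_2_eq_2 scalar_prod_def)
  then have "core_EP_inverse A = 0\<^sub>m 2 2" by (rule core_EP_inverse_nilpotent[OF A])
  moreover have "core_EP_inverse (0\<^sub>m 2 2) = 0\<^sub>m 2 2"
    by (rule core_EP_inverse_nilpotent[where j = 1]) auto
  ultimately have "core_EP_le A (0\<^sub>m 2 2)" "core_EP_le (0\<^sub>m 2 2) A"
    using A by (auto simp: core_EP_le_def)
  moreover have "A $$ (0, 1) \<noteq> 0\<^sub>m 2 2 $$ (0, 1)" by (simp add: A_def)
  then have "A \<noteq> 0\<^sub>m 2 2" by metis
  ultimately show "\<exists>n\<ge>1. \<exists>A\<in>carrier_mat n n. \<exists>B\<in>carrier_mat n n.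
       core_EP_le A B \<and> core_EP_le B A \<and> A \<noteq> B"
    using A by (intro exI[of _ 2] conjI bexI[of _ A] bexI[of _ "0\<^sub>m 2 2"]) auto
qed

end
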